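(* Let $m\ge3$, $n\ge2$, let $\mathcal{A}\in\mathbb{S}_{m,n}$ be strictly copositive, and let $\mathbb{M}$ be a subcone of $\mathbb{COP}_{m,n}$ with $\mathbb{M}\supseteq\mathbb{N}^+_{m,n}$. Then there exists $\varepsilon>0$ such that for every finite simplicial partition $\widetilde{S}=\{S_1,\dots,S_r\}$ of the standard simplex $S_0=\{\mathbf{x}\in\mathbb{R}^n_+:\|\mathbf{x}\|_1=1\}$ with $d(\widetilde{S})<\varepsilon$, we have $V_{S_k}^T\mathcal{A}V_{S_k}\in\mathbb{M}$ for all $k\in[r]$, where $V_{S_k}=(\mathbf{u}^k_1,\dots,\mathbf{u}^k_n)\in\mathbb{R}^{n\times n}$ and $\mathbf{u}^k_1,\dots,\mathbf{u}^k_n$ are the vertices of $S_k$.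
   Context: $\mathbb{S}_{m,n}$ denotes the set of real symmetric tensors of order $m$ and dimension $n$. $\mathcal{A}\mathbf{x}^m=\sum_{i_1,\dots,i_m}a_{i_1\cdots i_m}x_{i_1}\cdots x_{i_m}$. $\mathcal{A}$ is copositive (resp. strictly copositive) if $\mathcal{A}\mathbf{x}^m\ge0$ for all $\mathbf{x}\in\mathbb{R}^n_+$ (resp. $\mathcal{A}\mathbf{x}^m>0$ for all $\mathbf{x}\in\mathbb{R}^n_+\setminus\{\mathbf{0}\}$); $\mathbb{COP}_{m,n}$ is the cone of copositive tensors in $\mathbb{S}_{m,n}$ and $\mathbb{N}^+_{m,n}$ is the cone of entrywise nonnegative tensors in $\mathbb{S}_{m,n}$. For $V\in\mathbb{R}^{n\times n}$, $(V^T\mathcal{A}V)_{i_1\cdots i_m}=\sum_{j_1,\dots,j_m}a_{j_1\cdots j_m}V_{j_1i_1}\cdots V_{j_mi_m}$. A set $\{S_1,\dots,S_r\}$ of simplices is a simplicial partition of a simplex $S$ if $S=\bigcup_i S_i$ and $\mathrm{int}\,S_i\cap\mathrm{int}\,S_j=\emptyset$ for $i\ne j$. Its maximal diameter is $d(\widetilde S)=\max_{k\in[r]}\max_{i,j\in[n]}\|\mathbf{u}^k_i-\mathbf{u}^k_j\|_2$. *)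

theory Defs
  imports "HOL-Analysis.Analysis"
begin

text \<open>A real tensor of order \<open>m = CARD('m)\<close> and dimension \<open>n = CARD('n)\<close> is indexed by the
  multi-indices \<open>i :: 'm \<Rightarrow> 'n\<close>; its entry at position \<open>(i\<^sub>1, \<dots>, i\<^sub>m)\<close> is \<open>A $ i\<close>.\<close>

type_synonym ('m, 'n) tensor = "(real, 'm \<Rightarrow> 'n) vec"

definition symmetric_tensor :: "('m::finite, 'n::finite) tensor \<Rightarrow> bool" where
  "symmetric_tensor A \<longleftrightarrow> (\<forall>\<pi>. bij \<pi> \<longrightarrow> (\<forall>i. A $ (i \<circ> \<pi>) = A $ i))"

definition tensor_form :: "('m::finite, 'n::finite) tensor \<Rightarrow> real ^ 'n \<Rightarrow> real" where
  "tensor_form A x = (\<Sum>i\<in>UNIV. A $ i * (\<Prod>k\<in>UNIV. x $ i k))"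

definition copositive :: "('m::finite, 'n::finite) tensor \<Rightarrow> bool" where
  "copositive A \<longleftrightarrow> (\<forall>x. (\<forall>i. 0 \<le> x $ i) \<longrightarrow> 0 \<le> tensor_form A x)"

definition strictly_copositive :: "('m::finite, 'n::finite) tensor \<Rightarrow> bool" where
  "strictly_copositive A \<longleftrightarrow> (\<forall>x. (\<forall>i. 0 \<le> x $ i) \<and> x \<noteq> 0 \<longrightarrow> 0 < tensor_form A x)"

definition copositive_cone :: "('m::finite, 'n::finite) tensor set" where
  "copositive_cone = {A. symmetric_tensor A \<and> copositive A}"

definition nonneg_cone :: "('m::finite, 'n::finite) tensor set" where
  "nonneg_cone = {A. symmetric_tensor A \<and> (\<forall>i. 0 \<le> A $ i)}"

text \<open>The tensor \<open>V\<^sup>T A V\<close>:\<close>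

definition tensor_congruence ::
  "real ^ 'n ^ 'n \<Rightarrow> ('m::finite, 'n::finite) tensor \<Rightarrow> ('m, 'n) tensor" where
  "tensor_congruence V A = (\<chi> i. \<Sum>j\<in>UNIV. A $ j * (\<Prod>k\<in>UNIV. V $ j k $ i k))"

definition standard_simplex :: "(real ^ 'n) set" where
  "standard_simplex = {x. (\<forall>i. 0 \<le> x $ i) \<and> (\<Sum>i\<in>UNIV. \<bar>x $ i\<bar>) = 1}"

text \<open>The simplices here are the \<open>(n-1)\<close>-dimensional ones in \<open>\<real>\<^sup>n\<close>, i.e. those with \<open>n\<close> affinely
  independent vertices. Their topological interior in \<open>\<real>\<^sup>n\<close> is empty, so the interior in the
  definition of a partition is the relative one.\<close>

definition simplicial_partition :: "(real ^ 'n) set \<Rightarrow> (real ^ 'n) set set \<Rightarrow> bool" where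
  "simplicial_partition S P \<longleftrightarrow>
     finite P \<and> (\<forall>T\<in>P. (int CARD('n) - 1) simplex T) \<and> \<Union>P = S \<and>
     (\<forall>T\<in>P. \<forall>T'\<in>P. T \<noteq> T' \<longrightarrow> rel_interior T \<inter> rel_interior T' = {})"

definition vertices :: "(real ^ 'n) set \<Rightarrow> (real ^ 'n) set" where
  "vertices T = {u. u extreme_point_of T}"

definition max_diameter :: "(real ^ 'n) set set \<Rightarrow> real" where
  "max_diameter P = Max ((\<lambda>T. Max ((\<lambda>(u, v). norm (u - v)) ` (vertices T \<times> vertices T))) ` P)"

text \<open>The columns of \<open>V\<close> list the vertices of \<open>T\<close>, each once, in some order:\<close>

definition vertex_matrix :: "real ^ 'n ^ 'n \<Rightarrow> (real ^ 'n) set \<Rightarrow> bool" where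
  "vertex_matrix V T \<longleftrightarrow> bij_betw (\<lambda>i. column i V) UNIV (vertices T)"

end

theory Submission
  imports Defs
begin

text \<open>The entries of \<open>V\<^sup>T A V\<close> are the values of the multilinear form of \<open>A\<close> at tuples of vertices of
  one simplex. On the diagonal of the compact standard simplex this form has a positive minimum, and
  it is Lipschitz there, so its values at tuples of nearby points are positive as well; hence
  \<open>V\<^sup>T A V\<close> is even entrywise nonnegative.\<close>

text \<open>Renaming the summation index \<open>j\<close> to \<open>j \<circ> \<pi>\<close> moves
  the permutation from \<open>i\<close> onto the factors of \<open>A\<close> and of the product.
  Symmetry of \<open>A\<close> absorbs it in the first, commutativity of the product in the
  second.\<close>

lemma symmetric_tensor_congruence:
  assumes "symmetric_tensor A"
  shows "symmetric_tensor (tensor_congruence V A)"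
  unfolding symmetric_tensor_def
proof (intro allI impI)
  fix \<pi> :: "'a \<Rightarrow> 'a" and i :: "'a \<Rightarrow> 'b"
  assume \<pi>: "bij \<pi>"
  have bij: "bij (\<lambda>j. j \<circ> \<pi> :: 'a \<Rightarrow> 'b)"
    by (rule o_bij[where g = "\<lambda>j. j \<circ> inv \<pi>"])
      (use \<pi> in \<open>auto simp: fun_eq_iff bij_is_inj bij_is_surj surj_f_inv_f\<close>)
  have "(\<Sum>j\<in>UNIV. A $ j * (\<Prod>k\<in>UNIV. V $ j k $ (i \<circ> \<pi>) k)) =
      (\<Sum>j\<in>UNIV. A $ (j \<circ> \<pi>) * (\<Prod>k\<in>UNIV. V $ j (\<pi> k) $ i (\<pi> k)))"
    using sum.reindex_bij_betw[OF bij, of "\<lambda>j. A $ j * (\<Prod>k\<in>UNIV. V $ j k $ (i \<circ> \<pi>) k)"]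
    by simp
  also have "\<dots> = (\<Sum>j\<in>UNIV. A $ j * (\<Prod>k\<in>UNIV. V $ j k $ i k))"
  proof (rule sum.cong[OF refl])
    fix j
    have "A $ (j \<circ> \<pi>) = A $ j"
      using assms \<pi> by (simp add: symmetric_tensor_def)
    then show "A $ (j \<circ> \<pi>) * (\<Prod>k\<in>UNIV. V $ j (\<pi> k) $ i (\<pi> k)) = A $ j * (\<Prod>k\<in>UNIV. V $ j k $ i k)"
      using prod.reindex_bij_betw[OF \<pi>, of "\<lambda>k. V $ j k $ i k"] by simp
  qed
  finally show "tensor_congruence V A $ (i \<circ> \<pi>) = tensor_congruence V A $ i"
    by (simp add: tensor_congruence_def)
qed

lemma standard_simplex_bounds:
  assumes "x \<in> standard_simplex"
  shows "0 \<le> x $ i" "x $ i \<le> 1"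
proof -
  show "0 \<le> x $ i"
    using assms by (simp add: standard_simplex_def)
  have "\<bar>x $ i\<bar> \<le> (\<Sum>i\<in>UNIV. \<bar>x $ i\<bar>)"
    by (rule member_le_sum) auto
  also have "\<dots> = 1"
    using assms unfolding standard_simplex_def by blast
  finally show "x $ i \<le> 1"
    by simp
qed

lemma compact_standard_simplex: "compact (standard_simplex :: (real ^ 'n) set)"
proof -
  have "bounded (standard_simplex :: (real ^ 'n) set)"
  proof (rule boundedI)
    fix x :: "real ^ 'n"
    assume "x \<in> standard_simplex"
    then have "(\<Sum>i\<in>UNIV. \<bar>x $ i\<bar>) = 1"
      unfolding standard_simplex_def by blast
    then show "norm x \<le> 1"
      using norm_le_l1_cart[of x] by linarith
  qed
  moreover have "closed (standard_simplex :: (real ^ 'n) set)"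
    unfolding standard_simplex_def
    by (intro closed_Collect_conj closed_Collect_all closed_Collect_le closed_Collect_eq
        continuous_intros)
  ultimately show ?thesis
    by (simp add: compact_eq_bounded_closed)
qed

lemma strictly_copositive_bounded_below:
  fixes A :: "('m::finite, 'n::finite) tensor"
  assumes "strictly_copositive A"
  obtains \<delta> where "\<delta> > 0" "\<And>x. x \<in> standard_simplex \<Longrightarrow> \<delta> \<le> tensor_form A x"
proof -
  \<comment> \<open>A coordinate vector, with an arbitrary index, witnesses that the simplex is
    nonempty, which attaining the infimum requires.\<close>
  have "axis undefined 1 \<in> (standard_simplex :: (real ^ 'n) set)"
    by (simp add: standard_simplex_def axis_def if_distrib[of abs] cong: if_cong)
  then have "(standard_simplex :: (real ^ 'n) set) \<noteq> {}"
    by blast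
  moreover have "continuous_on standard_simplex (tensor_form A)"
    unfolding tensor_form_def by (intro continuous_intros)
  ultimately obtain x where x: "x \<in> standard_simplex"
    "\<And>y. y \<in> standard_simplex \<Longrightarrow> tensor_form A x \<le> tensor_form A y"
    using continuous_attains_inf[OF compact_standard_simplex] by blast
  have "x \<noteq> 0"
    using x(1) by (auto simp: standard_simplex_def)
  then have "tensor_form A x > 0"
    using assms x(1) by (simp add: strictly_copositive_def standard_simplex_def)
  with x(2) show ?thesis
    using that by blast
qed

text \<open>Entry \<open>i\<close> is the multilinear form of \<open>A\<close> at the columns
  \<open>i k\<close> of \<open>V\<close>, and \<open>tensor_form A x\<close> is the same form with
  \<open>x\<close> in every slot. Replacing the \<open>CARD('m)\<close> factors of a monomial one at
  a time costs at most \<open>e\<close> each, since coordinates of points of the simplex lie between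
  0 and 1. Weighting by the \<open>\<bar>A $ j\<bar>\<close> and summing gives the bound.\<close>

lemma tensor_congruence_diff_le:
  fixes A :: "('m::finite, 'n::finite) tensor" and e :: real
  assumes x: "x \<in> standard_simplex"
    and V: "\<And>j. column j V \<in> standard_simplex"
    and near: "\<And>j. norm (column j V - x) \<le> e"
  shows "\<bar>tensor_congruence V A $ i - tensor_form A x\<bar> \<le> (\<Sum>j\<in>UNIV. \<bar>A $ j\<bar>) * (CARD('m) * e)"
proof -
  have prod: "\<bar>(\<Prod>k\<in>UNIV. V $ j k $ i k) - (\<Prod>k\<in>UNIV. x $ j k)\<bar> \<le> CARD('m) * e"
    for j :: "'m \<Rightarrow> 'n"
  proof -
    have "\<bar>V $ j k $ i k\<bar> \<le> 1" for k
      using standard_simplex_bounds[OF V[of "i k"], of "j k"] by (simp add: column_def)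
    moreover have "\<bar>x $ j k\<bar> \<le> 1" for k
      using standard_simplex_bounds[OF x, of "j k"] by simp
    \<comment> \<open>Telescoping: a difference of products of factors of modulus at most 1 is
      bounded by the sum of the factorwise differences.\<close>
    ultimately have "\<bar>(\<Prod>k\<in>UNIV. V $ j k $ i k) - (\<Prod>k\<in>UNIV. x $ j k)\<bar> \<le>
        (\<Sum>k\<in>UNIV. \<bar>V $ j k $ i k - x $ j k\<bar>)"
      using norm_prod_diff[of UNIV "\<lambda>k. V $ j k $ i k" "\<lambda>k. x $ j k"] by simp
    also have "\<dots> \<le> (\<Sum>k\<in>(UNIV::'m set). e)"
    proof (rule sum_mono)
      fix k
      show "\<bar>V $ j k $ i k - x $ j k\<bar> \<le> e"
        using order_trans[OF component_le_norm_cart near, of "i k" "j k"]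
        by (simp add: column_def)
    qed
    finally show ?thesis
      by simp
  qed
  have "\<bar>tensor_congruence V A $ i - tensor_form A x\<bar> =
      \<bar>\<Sum>j\<in>UNIV. A $ j * ((\<Prod>k\<in>UNIV. V $ j k $ i k) - (\<Prod>k\<in>UNIV. x $ j k))\<bar>"
    by (simp add: tensor_congruence_def tensor_form_def right_diff_distrib sum_subtractf)
  also have "\<dots> \<le> (\<Sum>j\<in>UNIV. \<bar>A $ j\<bar> * \<bar>(\<Prod>k\<in>UNIV. V $ j k $ i k) - (\<Prod>k\<in>UNIV. x $ j k)\<bar>)"
    by (rule order_trans[OF sum_abs]) (simp add: abs_mult)
  also have "\<dots> \<le> (\<Sum>j\<in>UNIV. \<bar>A $ j\<bar> * (CARD('m) * e))"
    by (intro sum_mono mult_left_mono prod) simp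
  finally show ?thesis
    by (simp add: sum_distrib_right)
qed

text \<open>Extreme points of a convex hull belong to the generating set. Finiteness is what makes
  the inner \<open>Max\<close> in \<open>max_diameter\<close> an upper bound.\<close>

lemma finite_vertices_simplex:
  assumes "n simplex T"
  shows "finite (vertices T)"
proof -
  obtain C where C: "finite C" "T = convex hull C"
    using assms by (auto simp: simplex)
  have "vertices T \<subseteq> C"
    unfolding vertices_def C(2) by (auto dest: extreme_point_of_convex_hull)
  then show ?thesis
    using C(1) by (rule finite_subset)
qed

lemma norm_vertices_le_max_diameter:
  assumes "simplicial_partition S P" "T \<in> P" "u \<in> vertices T" "v \<in> vertices T"
  shows "norm (u - v) \<le> max_diameter P"
proof -
  have "finite (vertices T)"
    using assms(1,2) finite_vertices_simplex unfolding simplicial_partition_def by blast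
  then have "norm (u - v) \<le> Max ((\<lambda>(u, v). norm (u - v)) ` (vertices T \<times> vertices T))"
    using assms(3,4) by (intro Max_ge) auto
  also have "\<dots> \<le> max_diameter P"
    unfolding max_diameter_def
    using assms(1,2) by (intro Max_ge) (auto simp: simplicial_partition_def)
  finally show ?thesis .
qed

theorem theorem3p2:
  fixes A :: "('m::finite, 'n::finite) tensor"
    and M :: "('m, 'n) tensor set"
  assumes "CARD('m) \<ge> 3"
    and "CARD('n) \<ge> 2"
    and "symmetric_tensor A"
    and "strictly_copositive A"
    and "cone M"
    and "M \<subseteq> copositive_cone"
    and "nonneg_cone \<subseteq> M"
  shows "\<exists>\<epsilon>>0. \<forall>P. simplicial_partition standard_simplex P \<and> max_diameter P < \<epsilon> \<longrightarrow>
           (\<forall>T\<in>P. \<forall>V. vertex_matrix V T \<longrightarrow> tensor_congruence V A \<in> M)"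
proof -
  obtain \<delta> where \<delta>: "\<delta> > 0" "\<And>x. x \<in> standard_simplex \<Longrightarrow> \<delta> \<le> tensor_form A x"
    using strictly_copositive_bounded_below[OF assms(4)] by blast
  define B where "B = (\<Sum>j\<in>UNIV. \<bar>A $ j\<bar>)"
  have "B \<ge> 0"
    unfolding B_def by (intro sum_nonneg) simp
  \<comment> \<open>Chosen so that the Lipschitz error \<open>B * (CARD('m) * \<epsilon>)\<close> is
    at most \<open>\<delta>\<close>. Using \<open>B + 1\<close> keeps the denominator positive even
    where only \<open>B \<ge> 0\<close> is known.\<close>
  define \<epsilon> where "\<epsilon> = \<delta> / ((B + 1) * CARD('m))"
  have "\<epsilon> > 0"
    using \<delta>(1) \<open>B \<ge> 0\<close> by (simp add: \<epsilon>_def)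
  have "B * (CARD('m) * \<epsilon>) = \<delta> * (B / (B + 1))"
    by (simp add: \<epsilon>_def)
  also have "\<dots> \<le> \<delta> * 1"
    using \<delta>(1) \<open>B \<ge> 0\<close> by (intro mult_left_mono) auto
  finally have small: "B * (CARD('m) * \<epsilon>) \<le> \<delta>"
    by simp
  have "tensor_congruence V A \<in> M"
    if P: "simplicial_partition standard_simplex P" and diam: "max_diameter P < \<epsilon>"
      and T: "T \<in> P" and V: "vertex_matrix V T" for P T V
  proof -
    have col: "column j V \<in> vertices T" for j
      using V unfolding vertex_matrix_def by (rule bij_betwE[THEN bspec]) simp
    have "T \<subseteq> standard_simplex"
      using P T unfolding simplicial_partition_def by blast
    \<comment> \<open>Extreme points of \<open>T\<close> are members of \<open>T\<close>.\<close>
    then have simplex: "column j V \<in> standard_simplex" for j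
      using col[of j] by (auto simp: vertices_def extreme_point_of_def)
    have near: "norm (column j V - column l V) \<le> \<epsilon>" for j l
      using norm_vertices_le_max_diameter[OF P T col col, of j l] diam by linarith
    have "0 \<le> tensor_congruence V A $ i" for i
    proof -
      \<comment> \<open>Any column of \<open>V\<close> could serve as the reference point, as all
        columns are within \<open>\<epsilon>\<close> of each other; here it is the one in an
        arbitrary slot of \<open>i\<close>. The form is at least \<open>\<delta>\<close> there and
        the entry differs from it by at most \<open>\<delta>\<close>, so the entry is
        nonnegative.\<close>
      let ?x = "column (i undefined) V"
      have "\<bar>tensor_congruence V A $ i - tensor_form A ?x\<bar> \<le> \<delta>"
        using tensor_congruence_diff_le[OF simplex simplex near] small
        unfolding B_def by (rule order_trans)
      then show ?thesis
        using \<delta>(2)[OF simplex, of "i undefined"] by linarith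
    qed
    then have "tensor_congruence V A \<in> nonneg_cone"
      using symmetric_tensor_congruence[OF assms(3)] by (simp add: nonneg_cone_def)
    then show ?thesis
      using assms(7) by blast
  qed
  with \<open>\<epsilon> > 0\<close> show ?thesis
    by blast
qed

end
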